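(* Let $f$ be a convex function and $x_0\in\operatorname{dom} f$. Denote $K=\{x: f(x)\le f(x_0)\}$ and assume that $f\in\mathcal{H}_{s,L}\cap\mathcal{L}_{r,\mu}(K)$. Assume the minimum $f^*$ of $f$ is known. Put $\rho=\frac{3s}{2}-1$, $\kappa=L^{2/s}/\mu^{2/r}$, $\tau=1-s/r\in[0,1)$ and $c=8e^{2/e}$. Run from $x_0$, with $\epsilon_0=f(x_0)-f^*$ and parameter $\gamma=1$, the restart scheme $$\epsilon_k=e^{-\gamma}\epsilon_{k-1},\qquad x_k=\mathcal{C}(x_{k-1},\epsilon_k),\qquad k=1,\dots,R,$$ where $\mathcal{C}$ is the universal fast gradient method stopped when the target accuracy is reached (see context). The precision reached at the last point $\hat x=x_R$ is given by $$f(\hat x)-f^*\le\exp\left(-e^{-\frac1\rho}(c\kappa)^{-\frac{s}{2\rho}}N\right)(f(x_0)-f^* )=O\left(\exp(-\kappa^{-\frac{s}{2\rho}}N)\right),\quad\text{when }\tau=0,$$ while $$f(\hat x)-f^*\le\frac{f(x_0)-f^*}{\left(\frac{\tau}{\rho}e^{-\frac1\rho}(c\kappa)^{-\frac{s}{2\rho}}(f(x_0)-f^* )^{\frac{\tau}{\rho}}N+1\right)^{\frac{\rho}{\tau}}}=O\left(N^{-\frac{\rho}{\tau}}\right),\quad\text{when }\tau>0,$$ where $N$ is the total number of iterations. Those bounds are suboptimal to the best scheduled restarts by a factor at most $e/2\approx1.3$.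
   Context: $f$ is defined on $\mathbb{R}^n$; $X^*$ is its set of minimizers. $1\le s\le2$, $L>0$, $\mu>0$, $r\ge1$ are constants. $\mathcal{H}_{s,L}$ is the set of functions $f$ with $\|\nabla f(x)-\nabla f(y)\|_2\le L\|x-y\|_2^{s-1}$ for all $x,y\in\operatorname{dom} f$ and any subgradients $\nabla f(x)\in\partial f(x)$, $\nabla f(y)\in\partial f(y)$. $\mathcal{L}_{r,\mu}(K)$ is the set of functions $f$ satisfying the Łojasiewicz growth condition $\frac{\mu}{r}d(x,X^* )^r\le f(x)-f^*$ for every $x\in K$, where $d(x,X^* )=\min_{y\in X^*}\|x-y\|_2$. $\mathcal{U}$ denotes the universal fast gradient method with monotone objective values: given a starting point $x$, a target accuracy $\epsilon$ and a number of iterations $t$, it outputs a point $y=\mathcal{U}(x,\epsilon,t)$ such that $$f(y)-f^*\le\frac{\epsilon}{2}+\frac{c_0L^{2/s}d(x,X^* )^2}{\epsilon^{2/s}t^{2\rho/s}}\,\frac{\epsilon}{2},\qquad c_0=2^{\frac{4s-2}{s}},\qquad\text{and}\qquad f(y)\le f(x).$$ Since $f^*$ is known, the method can be stopped when it reaches the target accuracy: $\mathcal{C}(x,\epsilon)=\mathcal{U}(x,\epsilon,t_\epsilon)$, where $t_\epsilon$ is the number of inner iterations at which $f(\mathcal{U}(x,\epsilon,t_\epsilon))-f^*\le\epsilon$ is first reached. The total number of iterations $N$ is the sum over $k=1,\dots,R$ of the numbers of inner iterations of the calls $\mathcal{C}(x_{k-1},\epsilon_k)$. Iteration counts are treated as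 real numbers (rounding to integers is ignored). Scheduled restarts are schemes $\epsilon_k=e^{-\gamma}\epsilon_{k-1}$, $x_k=\mathcal{U}(x_{k-1},\epsilon_k,t_k)$ in which the $t_k$ are fixed in advance; the best one referred to here uses $\gamma=\rho$ and $t_k=e^{1-\tau}(c\kappa)^{\frac{s}{2\rho}}\epsilon_0^{-\frac{\tau}{\rho}}e^{\tau k}$.
   Formalization: For τ=0 the claim "=O(exp(−κ^{−s/(2ρ)}N))" is false as literally written, since the displayed bound decays at a strictly smaller rate; it is proved as O(exp(−aκ^{−s/(2ρ)}N)) with an absolute constant a>0. *)

theory Defs
  imports "HOL-Analysis.Analysis" "HOL-Library.Landau_Symbols"
begin

text \<open>
  An objective is a pair of a set \<open>D\<close> (the domain \<open>dom f\<close>) and a real function \<open>f\<close>, whose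
  values outside \<open>D\<close> are irrelevant; \<open>D = UNIV\<close> is the case of a function that is finite
  everywhere.
\<close>

definition minimizers :: "'a set \<Rightarrow> ('a \<Rightarrow> real) \<Rightarrow> 'a set" where
  "minimizers D f = {x. is_arg_min f (\<lambda>x. x \<in> D) x}"

text \<open>The minimum \<open>f\<^sup>*\<close>; only used when \<^term>\<open>minimizers D f \<noteq> {}\<close>.\<close>

definition min_value :: "'a set \<Rightarrow> ('a \<Rightarrow> real) \<Rightarrow> real" where
  "min_value D f = (INF x\<in>D. f x)"

abbreviation gap :: "'a set \<Rightarrow> ('a \<Rightarrow> real) \<Rightarrow> 'a \<Rightarrow> real" where
  "gap D f x \<equiv> f x - min_value D f"

definition subdifferential :: "'a::real_inner set \<Rightarrow> ('a \<Rightarrow> real) \<Rightarrow> 'a \<Rightarrow> 'a set" where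
  "subdifferential D f x = {g. \<forall>y\<in>D. f x + g \<bullet> (y - x) \<le> f y}"

text \<open>
  For \<open>s = 1\<close> the right-hand side is the constant \<open>L\<close>, also when \<open>x = y\<close>. The case
  distinction is needed because \<^term>\<open>0 powr 0 = (0::real)\<close>, which would force
  subgradients to be unique.
\<close>

definition holder_class :: "'a::real_inner set \<Rightarrow> real \<Rightarrow> real \<Rightarrow> ('a \<Rightarrow> real) set" where
  "holder_class D s L = {f. \<forall>x\<in>D. \<forall>y\<in>D. \<forall>g\<in>subdifferential D f x. \<forall>h\<in>subdifferential D f y.
     norm (g - h) \<le> L * (if s = 1 then 1 else norm (x - y) powr (s - 1))}"

definition lojasiewicz_class ::
  "'a::metric_space set \<Rightarrow> real \<Rightarrow> real \<Rightarrow> 'a set \<Rightarrow> ('a \<Rightarrow> real) set" where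
  "lojasiewicz_class D r \<mu> K =
     {f. \<forall>x\<in>K. \<mu> / r * infdist x (minimizers D f) powr r \<le> gap D f x}"

definition rho :: "real \<Rightarrow> real" where
  "rho s = 3 * s / 2 - 1"

definition kappa :: "real \<Rightarrow> real \<Rightarrow> real \<Rightarrow> real \<Rightarrow> real" where
  "kappa s L r \<mu> = L powr (2 / s) / \<mu> powr (2 / r)"

definition tau :: "real \<Rightarrow> real \<Rightarrow> real" where
  "tau s r = 1 - s / r"

definition c_const :: real where
  "c_const = 8 * exp (2 / exp 1)"

text \<open>
  \<open>U x \<epsilon> t\<close> is the output of the method from \<open>x\<close> with target accuracy \<open>\<epsilon>\<close> after \<open>t\<close>
  iterations. Iteration counts are real numbers. For \<open>t = 0\<close> the error bound is infinite, so
  only monotonicity is required there.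
\<close>

definition universal_fast_gradient ::
  "'a::metric_space set \<Rightarrow> ('a \<Rightarrow> real) \<Rightarrow> real \<Rightarrow> real \<Rightarrow> ('a \<Rightarrow> real \<Rightarrow> real \<Rightarrow> 'a) \<Rightarrow> bool" where
  "universal_fast_gradient D f s L U \<longleftrightarrow>
     (\<forall>x\<in>D. \<forall>\<epsilon>>0. \<forall>t\<ge>0.
        U x \<epsilon> t \<in> D \<and> f (U x \<epsilon> t) \<le> f x \<and>
        (t > 0 \<longrightarrow> gap D f (U x \<epsilon> t) \<le>
           \<epsilon> / 2 + 2 powr ((4 * s - 2) / s) * L powr (2 / s) * (infdist x (minimizers D f))\<^sup>2
                   / (\<epsilon> powr (2 / s) * t powr (2 * rho s / s)) * (\<epsilon> / 2)))"

text \<open>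
  \<open>t\<close> is the stopping time \<open>t\<^sub>\<epsilon>\<close> of the method run from \<open>x\<close>, so that
  \<open>\<C>(x, \<epsilon>) = U x \<epsilon> t\<close>. As \<open>t\<close> is real, being first reached at \<open>t\<close> includes that the
  accuracy is reached at \<open>t\<close> itself.
\<close>

definition first_reached ::
  "'a set \<Rightarrow> ('a \<Rightarrow> real) \<Rightarrow> ('a \<Rightarrow> real \<Rightarrow> real \<Rightarrow> 'a) \<Rightarrow> 'a \<Rightarrow> real \<Rightarrow> real \<Rightarrow> bool" where
  "first_reached D f U x \<epsilon> t \<longleftrightarrow>
     t \<ge> 0 \<and> gap D f (U x \<epsilon> t) \<le> \<epsilon> \<and> (\<forall>t'. 0 \<le> t' \<and> t' < t \<longrightarrow> \<not> gap D f (U x \<epsilon> t') \<le> \<epsilon>)"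

primrec target :: "real \<Rightarrow> real \<Rightarrow> nat \<Rightarrow> real" where
  "target \<gamma> \<epsilon>0 0 = \<epsilon>0"
| "target \<gamma> \<epsilon>0 (Suc k) = exp (- \<gamma>) * target \<gamma> \<epsilon>0 k"

text \<open>
  Runs of the two restart schemes, with iterates \<open>x 0, \<dots>, x R\<close> and inner iteration counts
  \<open>t 1, \<dots>, t R\<close>: in the first scheme the \<open>t k\<close> are determined by the stopping criterion, in
  the second one they are prescribed.
\<close>

definition criterion_restarts ::
  "'a set \<Rightarrow> ('a \<Rightarrow> real) \<Rightarrow> ('a \<Rightarrow> real \<Rightarrow> real \<Rightarrow> 'a) \<Rightarrow> real \<Rightarrow> 'a \<Rightarrow> nat \<Rightarrow>
     (nat \<Rightarrow> 'a) \<Rightarrow> (nat \<Rightarrow> real) \<Rightarrow> bool" where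
  "criterion_restarts D f U \<gamma> x0 R x t \<longleftrightarrow>
     x 0 = x0 \<and>
     (\<forall>k\<in>{1..R}. first_reached D f U (x (k - 1)) (target \<gamma> (gap D f x0) k) (t k) \<and>
                 x k = U (x (k - 1)) (target \<gamma> (gap D f x0) k) (t k))"

definition scheduled_restarts ::
  "'a set \<Rightarrow> ('a \<Rightarrow> real) \<Rightarrow> ('a \<Rightarrow> real \<Rightarrow> real \<Rightarrow> 'a) \<Rightarrow> real \<Rightarrow> 'a \<Rightarrow> nat \<Rightarrow>
     (nat \<Rightarrow> 'a) \<Rightarrow> (nat \<Rightarrow> real) \<Rightarrow> bool" where
  "scheduled_restarts D f U \<gamma> x0 R x t \<longleftrightarrow>
     x 0 = x0 \<and> (\<forall>k\<in>{1..R}. x k = U (x (k - 1)) (target \<gamma> (gap D f x0) k) (t k))"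

text \<open>The inner iteration counts of the best schedule, which is run with \<open>\<gamma> = \<rho>\<close>.\<close>

definition best_schedule :: "real \<Rightarrow> real \<Rightarrow> real \<Rightarrow> real \<Rightarrow> nat \<Rightarrow> real" where
  "best_schedule s r \<kappa> \<epsilon>0 k =
     exp (1 - tau s r) * (c_const * \<kappa>) powr (s / (2 * rho s)) * \<epsilon>0 powr (- tau s r / rho s)
       * exp (tau s r * real k)"

text \<open>
  Precision bounds after \<open>N\<close> inner iterations in total, with initial gap \<open>\<Delta>\<close>, for the two
  schemes. In the second one, the coefficient of \<open>N\<close> comes from summing the counts
  \<^const>\<open>best_schedule\<close> and using \<open>e\<^sup>\<tau> - 1 \<ge> \<tau>\<close>, in the same way as \<open>e\<^bsup>\<tau>/\<rho>\<^esup> - 1 \<ge> \<tau>/\<rho>\<close> is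
  used for the first one.
\<close>

definition criterion_bound :: "real \<Rightarrow> real \<Rightarrow> real \<Rightarrow> real \<Rightarrow> real \<Rightarrow> real" where
  "criterion_bound s r \<kappa> \<Delta> N =
     (if tau s r = 0
      then exp (- (exp (- 1 / rho s) * (c_const * \<kappa>) powr (- s / (2 * rho s)) * N)) * \<Delta>
      else \<Delta> / (tau s r / rho s * exp (- 1 / rho s) * (c_const * \<kappa>) powr (- s / (2 * rho s))
                  * \<Delta> powr (tau s r / rho s) * N + 1) powr (rho s / tau s r))"

definition scheduled_bound :: "real \<Rightarrow> real \<Rightarrow> real \<Rightarrow> real \<Rightarrow> real \<Rightarrow> real" where
  "scheduled_bound s r \<kappa> \<Delta> N =
     (if tau s r = 0
      then exp (- (rho s * exp (- 1) * (c_const * \<kappa>) powr (- s / (2 * rho s)) * N)) * \<Delta>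
      else \<Delta> / (tau s r * exp (- 1) * (c_const * \<kappa>) powr (- s / (2 * rho s))
                  * \<Delta> powr (tau s r / rho s) * N + 1) powr (rho s / tau s r))"

end

theory Submission
  imports Defs
begin

text \<open>
  With \<open>d(x, X\<^sup>*)\<close> controlled by the growth condition, the error bound of the method shows that
  a restart whose gap is at most \<open>e\<^sup>\<gamma> \<epsilon>\<close> reaches accuracy \<open>\<epsilon>\<close> after
  \<open>(c\<kappa>)\<^bsup>s/2\<rho>\<^esup> e\<^bsup>\<gamma>(1-\<tau>)/\<rho>\<^esup> \<epsilon>\<^bsup>-\<tau>/\<rho>\<^esup>\<close> iterations. These
  counts form a geometric progression, and comparing its sum with the final accuracy
  \<open>e\<^bsup>-\<gamma>R\<^esup> \<Delta>\<close> gives a bound in terms of the total count. The criterion is \<open>\<gamma> = 1\<close>,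
  where the counts only bound the stopping times, and the best schedule is \<open>\<gamma> = \<rho>\<close>. The loss
  factor reduces to \<open>2\<rho> \<le> e\<^bsup>2-1/\<rho>\<^esup>\<close> for \<open>1/2 \<le> \<rho> \<le> 2\<close>.
\<close>

section \<open>Constants and elementary estimates\<close>

lemma rho_bounds:
  assumes "1 \<le> s" "s \<le> 2"
  shows "1/2 \<le> rho s" "rho s \<le> 2"
  using assms by (auto simp: rho_def)

lemma c_const_pos: "c_const > 0"
  by (simp add: c_const_def)

lemma kappa_pos:
  assumes "L > 0" "\<mu> > 0"
  shows "kappa s L r \<mu> > 0"
  using assms by (simp add: kappa_def)

lemma target_eq: "target \<gamma> \<Delta> k = exp (- (\<gamma> * real k)) * \<Delta>"
  by (induction k) (auto simp: algebra_simps exp_add exp_diff exp_minus field_simps)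

text \<open>The map \<open>r \<mapsto> r powr (1 / r)\<close> peaks at \<open>r = exp 1\<close>, by
  \<open>ln z \<le> z - 1\<close> at \<open>z = r / exp 1\<close>. The peak accounts for the factor
  \<open>exp (2 / exp 1)\<close> in \<open>c_const\<close>.\<close>

lemma powr_two_over_self_le:
  fixes r :: real
  assumes "r > 0"
  shows "r powr (2 / r) \<le> exp (2 / exp 1)"
proof -
  have "ln (r / exp 1) \<le> r / exp 1 - 1"
    by (rule ln_le_minus_one) (use assms in simp)
  then have "ln r / r \<le> 1 / exp 1"
    using assms by (simp add: ln_div field_simps)
  then show ?thesis
    using assms by (simp add: powr_def)
qed

lemma exp_one_bounds: "2.6 \<le> exp (1::real)" "exp (1::real) < 2.8"
proof -
  \<comment> \<open>Expanding at 1/2 and squaring gives 169/64 > 2.6, whereas the quadratic at 1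
    stops at 2.5.\<close>
  have "1 + 1/2 + (1/2)\<^sup>2 / 2 \<le> exp (1/2::real)"
    by (rule exp_lower_Taylor_quadratic) simp
  then have "(13/8) * (13/8) \<le> exp (1/2::real) * exp (1/2)"
    by (intro mult_mono) (auto simp: power2_eq_square)
  then show "2.6 \<le> exp (1::real)"
    by (simp flip: exp_add)
  show "exp (1::real) < 2.8"
    using e_less_272 by simp
qed

lemma two_mul_le_exp:
  fixes \<rho> :: real
  assumes "1/2 \<le> \<rho>" "\<rho> \<le> 2"
  shows "2 * \<rho> \<le> exp (2 - 1 / \<rho>)"
proof -
  \<comment> \<open>Concavity of \<open>ln\<close> on \<open>[1/4, 1]\<close>, applied at \<open>1/(2\<rho>)\<close>, reduces the claim to its end points.\<close>
  define u where "u = 1 / (2 * \<rho>)"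
  have u: "1/4 \<le> u" "u \<le> 1"
    using assms by (auto simp: u_def field_simps)
  \<comment> \<open>\<open>w\<close> solves \<open>w / 4 + (1 - w) = u\<close>.\<close>
  define w where "w = (1 - u) * 4 / 3"
  have w: "0 \<le> w" "w \<le> 1"
    using u by (auto simp: w_def)
  have *: "w * ln (1/4) + (1 - w) * ln 1 \<le> ln (w *\<^sub>R (1/4) + (1 - w) *\<^sub>R (1::real))"
    by (rule ln_concave[unfolded concave_on_iff, THEN conjunct2, rule_format]) (use w in auto)
  have comb: "w *\<^sub>R (1/4) + (1 - w) *\<^sub>R (1::real) = u"
    by (simp add: w_def field_simps)
  have "w * ln (1/4) \<le> ln u"
    using *[unfolded comb] by simp
  \<comment> \<open>The value -3/2 is that of the line \<open>2 * u - 2\<close> at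
    \<open>u = 1/4\<close>; at \<open>u = 1\<close> the line and \<open>ln\<close> agree.\<close>
  moreover have "ln (1/4::real) \<ge> - 3/2"
  proof -
    have "ln (1/4::real) = - (2 * ln 2)"
      using ln_realpow[of 2 2] by (simp add: ln_div)
    then show ?thesis
      using ln2_le_25_over_36 by simp
  qed
  then have "w * (- 3/2) \<le> w * ln (1/4)"
    using w by (intro mult_left_mono) auto
  moreover have "w * (- 3/2) = 2 * u - 2"
    by (simp add: w_def field_simps)
  ultimately have "2 * u - 2 \<le> ln u"
    by simp
  moreover have "ln u = - ln (2 * \<rho>)"
    using assms by (simp add: u_def ln_div)
  ultimately have "ln (2 * \<rho>) \<le> 2 - 1 / \<rho>"
    by (simp add: u_def)
  then show ?thesis
    using assms ln_ge_iff[of "2 * \<rho>"] exp_le_cancel_iff[of "ln (2 * \<rho>)" "2 - 1 / \<rho>"] by simp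
qed

section \<open>A single restart\<close>

text \<open>The growth condition turns the gap bound into a bound on the squared distance to the
  minimizers; the threshold on \<open>t\<close> is chosen so that the second summand of the method's
  error bound is then at most \<open>\<epsilon> / 2\<close>.\<close>

lemma restart_step:
  fixes D :: "'a::metric_space set"
  assumes s: "1 \<le> s" "s \<le> 2" and pos: "L > 0" "\<mu> > 0" "r \<ge> 1"
    and U: "universal_fast_gradient D f s L U" and x: "x \<in> D"
    and loj: "\<mu> / r * infdist x (minimizers D f) powr r \<le> gap D f x"
    and gap: "gap D f x \<le> exp \<gamma> * \<epsilon>" and \<epsilon>: "\<epsilon> > 0"
    and t: "t \<ge> (c_const * kappa s L r \<mu>) powr (s / (2 * rho s)) * exp (\<gamma> * (1 - tau s r) / rho s)
               * \<epsilon> powr (- (tau s r / rho s))"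
  shows "gap D f (U x \<epsilon> t) \<le> \<epsilon>"
proof -
  define d where "d = infdist x (minimizers D f)"
  define T where "T = (c_const * kappa s L r \<mu>) powr (s / (2 * rho s))
    * exp (\<gamma> * (1 - tau s r) / rho s) * \<epsilon> powr (- (tau s r / rho s))"
  define A where "A = 2 powr ((4 * s - 2) / s) * L powr (2 / s) * d\<^sup>2"
  note rho = rho_bounds[OF s]
  have c\<kappa>: "c_const > 0" "kappa s L r \<mu> > 0"
    using c_const_pos kappa_pos[OF pos(1,2)] by simp_all
  have T: "T > 0" "T \<le> t"
    using c\<kappa> \<epsilon> t unfolding T_def by (intro mult_pos_pos, simp_all)
  have d: "d \<ge> 0"
    by (simp add: d_def infdist_nonneg)
  have "d powr r \<le> r / \<mu> * (exp \<gamma> * \<epsilon>)"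
    using order_trans[OF loj gap] pos by (simp add: d_def field_simps)
  then have "(d powr r) powr (2 / r) \<le> (r / \<mu> * (exp \<gamma> * \<epsilon>)) powr (2 / r)"
    using pos by (intro powr_mono2) auto
  moreover have "(d powr r) powr (2 / r) = d\<^sup>2"
    using d pos by (cases "d = 0") (auto simp: powr_powr)
  moreover have "(r / \<mu> * (exp \<gamma> * \<epsilon>)) powr (2 / r)
      = r powr (2 / r) / \<mu> powr (2 / r) * (exp (2 * \<gamma> / r) * \<epsilon> powr (2 / r))"
    using pos \<epsilon> by (simp add: powr_mult powr_divide exp_powr_real mult.commute)
  ultimately have "d\<^sup>2 \<le> r powr (2 / r) / \<mu> powr (2 / r) * (exp (2 * \<gamma> / r) * \<epsilon> powr (2 / r))"
    by simp
  also have "\<dots> \<le> exp (2 / exp 1) / \<mu> powr (2 / r) * (exp (2 * \<gamma> / r) * \<epsilon> powr (2 / r))"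
    using pos by (intro mult_right_mono divide_right_mono powr_two_over_self_le) auto
  finally have d2: "d\<^sup>2 \<le> exp (2 / exp 1) / \<mu> powr (2 / r) * (exp (2 * \<gamma> / r) * \<epsilon> powr (2 / r))" .
  \<comment> \<open>The exponent is \<open>4 - 2 / s\<close>, at most 3 as \<open>s \<le> 2\<close>;
    hence the 8 in \<open>c_const\<close>.\<close>
  have "2 powr ((4 * s - 2) / s) \<le> (2::real) powr 3"
    using s by (intro powr_mono) (auto simp: field_simps)
  then have "A \<le> 8 * L powr (2 / s)
      * (exp (2 / exp 1) / \<mu> powr (2 / r) * (exp (2 * \<gamma> / r) * \<epsilon> powr (2 / r)))"
    unfolding A_def using d2 by (intro mult_mono) auto
  also have "\<dots> = c_const * kappa s L r \<mu> * exp (2 * \<gamma> / r) * \<epsilon> powr (2 / r)"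
    by (simp add: c_const_def kappa_def)
  \<comment> \<open>\<open>T\<close> is the exact solution of this equation; the exponents match
    because \<open>1 - tau s r = s / r\<close>.\<close>
  also have "\<dots> = T powr (2 * rho s / s) * \<epsilon> powr (2 / s)"
  proof -
    have e1: "\<gamma> * (1 - tau s r) / rho s * (2 * rho s / s) = 2 * \<gamma> / r"
      using s pos rho by (simp add: tau_def field_simps)
    have e2: "- (tau s r / rho s) * (2 * rho s / s) + 2 / s = 2 / r"
      using s pos rho by (simp add: tau_def field_simps)
    have e3: "s / (2 * rho s) * (2 * rho s / s) = 1"
      using s rho by simp
    have "T powr (2 * rho s / s) = c_const * kappa s L r \<mu> * exp (2 * \<gamma> / r)
        * \<epsilon> powr (- (tau s r / rho s) * (2 * rho s / s))"
      unfolding T_def powr_mult powr_powr exp_powr_real e1 e3 using c\<kappa> by simp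
    then show ?thesis
      by (simp only: mult.assoc powr_add[symmetric] e2)
  qed
  also have "\<dots> \<le> \<epsilon> powr (2 / s) * t powr (2 * rho s / s)"
    using T s rho by (subst mult.commute, intro mult_left_mono powr_mono2) auto
  finally have "A / (\<epsilon> powr (2 / s) * t powr (2 * rho s / s)) \<le> 1"
    using \<epsilon> T by (simp add: divide_le_eq)
  then have "A / (\<epsilon> powr (2 / s) * t powr (2 * rho s / s)) * (\<epsilon> / 2) \<le> 1 * (\<epsilon> / 2)"
    using \<epsilon> by (intro mult_right_mono) auto
  moreover have "gap D f (U x \<epsilon> t)
      \<le> \<epsilon> / 2 + A / (\<epsilon> powr (2 / s) * t powr (2 * rho s / s)) * (\<epsilon> / 2)"
    using U x \<epsilon> T unfolding universal_fast_gradient_def A_def d_def by auto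
  ultimately show ?thesis
    by simp
qed

section \<open>Total iteration count against final accuracy\<close>

text \<open>The exact geometric sum has the denominator \<open>exp q - 1\<close>; since this is at
  least \<open>q\<close>, each term times \<open>q\<close> is dominated by a telescoping
  difference.\<close>

lemma mult_sum_exp_le:
  fixes q :: real
  shows "q * (\<Sum>k=1..R. exp (q * real k)) \<le> exp q * (exp (q * real R) - 1)"
proof (induction R)
  case (Suc R)
  have "q * exp (q * real (Suc R)) \<le> (exp q - 1) * exp (q * real (Suc R))"
    using exp_ge_add_one_self[of q] by (intro mult_right_mono) (simp_all add: add.commute le_diff_eq)
  also have "\<dots> = exp q * (exp (q * real (Suc R)) - exp (q * real R))"
    by (simp add: algebra_simps exp_add)
  finally show ?case
    using Suc by (simp add: algebra_simps)
qed simp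

text \<open>\<open>C\<close> stands for \<open>(c\<kappa>)\<^bsup>s/2\<rho>\<^esup>\<close>.\<close>

definition restart_bound :: "real \<Rightarrow> real \<Rightarrow> real \<Rightarrow> real \<Rightarrow> real \<Rightarrow> real \<Rightarrow> real" where
  "restart_bound \<gamma> \<rho> \<tau> C \<Delta> N =
     (if \<tau> = 0 then exp (- (\<gamma> * exp (- (\<gamma> / \<rho>)) / C * N)) * \<Delta>
      else \<Delta> / (\<gamma> * \<tau> / \<rho> * exp (- (\<gamma> / \<rho>)) / C * \<Delta> powr (\<tau> / \<rho>) * N + 1) powr (\<rho> / \<tau>))"

text \<open>The sum in the last assumption adds up the thresholds of \<open>restart_step\<close> for
  the targets \<open>exp (- (\<gamma> * k)) * \<Delta>\<close>. A large \<open>N\<close> therefore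
  forces a large \<open>R\<close>, and eliminating \<open>R\<close> leaves a bound in
  \<open>N\<close> alone.\<close>

lemma exp_le_restart_bound:
  assumes pos: "\<gamma> > 0" "\<rho> > 0" "\<tau> \<ge> 0" "C > 0" "\<Delta> > 0" and N: "0 \<le> N"
    "N \<le> (\<Sum>k=1..R. C * exp (\<gamma> * (1 - \<tau>) / \<rho>) * (exp (- (\<gamma> * real k)) * \<Delta>) powr (- (\<tau> / \<rho>)))"
  shows "exp (- (\<gamma> * real R)) * \<Delta> \<le> restart_bound \<gamma> \<rho> \<tau> C \<Delta> N"
proof (cases "\<tau> = 0")
  case True
  \<comment> \<open>All thresholds coincide here, so their sum is linear in
    \<open>R\<close>.\<close>
  with N pos have "N \<le> real R * (C * exp (\<gamma> / \<rho>))"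
    by simp
  then have "\<gamma> * (exp (- (\<gamma> / \<rho>)) / C) * N \<le> \<gamma> * (exp (- (\<gamma> / \<rho>)) / C) * (real R * (C * exp (\<gamma> / \<rho>)))"
    using pos by (intro mult_left_mono) auto
  also have "\<dots> = \<gamma> * real R"
    using pos by (simp add: exp_minus)
  finally show ?thesis
    using True pos by (simp add: restart_bound_def)
next
  case False
  with pos have \<tau>: "\<tau> > 0"
    by simp
  \<comment> \<open>\<open>q\<close> is the logarithmic growth of the thresholds from one restart to
    the next, \<open>B\<close> the coefficient of \<open>N\<close> in
    \<open>restart_bound\<close>.\<close>
  define q where "q = \<gamma> * \<tau> / \<rho>"
  define B where "B = q * exp (- (\<gamma> / \<rho>)) / C * \<Delta> powr (\<tau> / \<rho>)"
  have q: "q > 0"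
    using pos \<tau> by (simp add: q_def)
  have B: "B > 0"
    using pos q by (simp add: B_def)
  have "C * exp (\<gamma> * (1 - \<tau>) / \<rho>) * (exp (- (\<gamma> * real k)) * \<Delta>) powr (- (\<tau> / \<rho>))
      = C * exp (\<gamma> / \<rho> - q) * \<Delta> powr (- (\<tau> / \<rho>)) * exp (q * real k)" for k
    using pos by (simp add: powr_mult exp_powr_real q_def algebra_simps diff_divide_distrib)
  with N have "N \<le> C * exp (\<gamma> / \<rho> - q) * \<Delta> powr (- (\<tau> / \<rho>)) * (\<Sum>k=1..R. exp (q * real k))"
    by (simp add: sum_distrib_left)
  then have "B * N \<le> B * (C * exp (\<gamma> / \<rho> - q) * \<Delta> powr (- (\<tau> / \<rho>)) * (\<Sum>k=1..R. exp (q * real k)))"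
    using B by (intro mult_left_mono) auto
  also have "\<dots> = exp (- q) * (q * (\<Sum>k=1..R. exp (q * real k)))"
    using pos by (simp add: B_def exp_diff exp_minus powr_minus divide_inverse mult_ac)
  also have "\<dots> \<le> exp (- q) * (exp q * (exp (q * real R) - 1))"
    by (intro mult_left_mono mult_sum_exp_le) auto
  also have "\<dots> = exp (q * real R) - 1"
    by (simp add: exp_minus)
  \<comment> \<open>The power \<rho>/\<tau> is the one that turns \<open>exp (q * R)\<close> into
    \<open>exp (\<gamma> * R)\<close>, since \<open>q * \<rho> / \<tau> = \<gamma>\<close>.\<close>
  finally have "(B * N + 1) powr (\<rho> / \<tau>) \<le> exp (q * real R) powr (\<rho> / \<tau>)"
    using B N pos \<tau> by (intro powr_mono2) auto
  also have "\<dots> = exp (\<gamma> * real R)"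
    using pos \<tau> by (simp add: exp_powr_real q_def)
  finally have "\<Delta> / exp (\<gamma> * real R) \<le> \<Delta> / (B * N + 1) powr (\<rho> / \<tau>)"
    using B N pos by (intro divide_left_mono) (auto simp: add_nonneg_eq_0_iff)
  then show ?thesis
    using False by (simp add: restart_bound_def B_def q_def exp_minus field_simps)
qed

section \<open>Induction along the restarts\<close>

text \<open>Both schemes are treated at once: a run with the stopping criterion is a scheduled run
  whose counts happen to be the stopping times. The disjunction \<open>counts\<close> separates
  stopping times from counts equal to the thresholds of \<open>restart_step\<close>.\<close>

lemma restarts_bound:
  fixes D :: "'a::metric_space set"
  assumes s: "1 \<le> s" "s \<le> 2" and pos: "L > 0" "\<mu> > 0" "r \<ge> 1" "\<gamma> > 0" "tau s r \<ge> 0"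
    and U: "universal_fast_gradient D f s L U" and x0: "x0 \<in> D"
    and loj: "f \<in> lojasiewicz_class D r \<mu> {z \<in> D. f z \<le> f x0}"
    and gap0: "gap D f x0 > 0"
    and run: "scheduled_restarts D f U \<gamma> x0 R x t"
    and t: "\<And>k. k \<in> {1..R} \<Longrightarrow> t k \<ge> 0"
    and C: "C = (c_const * kappa s L r \<mu>) powr (s / (2 * rho s))"
    and counts: "(\<forall>k\<in>{1..R}. first_reached D f U (x (k - 1)) (target \<gamma> (gap D f x0) k) (t k)) \<or>
      (\<forall>k\<in>{1..R}. t k = C * exp (\<gamma> * (1 - tau s r) / rho s)
        * target \<gamma> (gap D f x0) k powr (- (tau s r / rho s)))"
  shows "gap D f (x R) \<le> restart_bound \<gamma> (rho s) (tau s r) C (gap D f x0) (\<Sum>k=1..R. t k)"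
proof -
  define \<Delta> where "\<Delta> = gap D f x0"
  define \<epsilon> where "\<epsilon> = target \<gamma> \<Delta>"
  define T where "T k = C * exp (\<gamma> * (1 - tau s r) / rho s) * \<epsilon> k powr (- (tau s r / rho s))" for k
  have \<epsilon>: "\<epsilon> k > 0" for k
    using gap0 by (simp add: \<epsilon>_def \<Delta>_def target_eq)
  have step: "x (Suc k) = U (x k) (\<epsilon> (Suc k)) (t (Suc k))" if "k < R" for k
    using that bspec[OF conjunct2[OF run[unfolded scheduled_restarts_def]], of "Suc k"]
    by (simp add: \<epsilon>_def \<Delta>_def del: target.simps)
  have C0: "C > 0"
    using C c_const_pos kappa_pos[OF pos(1,2), of s r] by simp
  have T0: "T k > 0" for k
    using C0 \<epsilon>[of k] by (simp add: T_def)
  \<comment> \<open>\<open>restart_step\<close> applies because the targets shrink by exactly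
    \<open>exp (- \<gamma>)\<close>, so a gap below one target is at most
    \<open>exp \<gamma>\<close> times the next.\<close>
  have reach: "gap D f (U (x k) (\<epsilon> (Suc k)) u) \<le> \<epsilon> (Suc k)"
    if "x k \<in> D" "f (x k) \<le> f x0" "gap D f (x k) \<le> \<epsilon> k" "u \<ge> T (Suc k)" for k u
  proof (rule restart_step[OF s pos(1-3) U])
    show "gap D f (x k) \<le> exp \<gamma> * \<epsilon> (Suc k)"
      using that by (simp add: \<epsilon>_def exp_minus mult.assoc[symmetric])
  qed (use that loj \<epsilon> in \<open>auto simp: lojasiewicz_class_def T_def C\<close>)
  \<comment> \<open>Monotonicity of the method is carried along because the growth condition is
    assumed only on the sublevel set of \<open>x0\<close>.\<close>
  have inv: "x k \<in> D \<and> f (x k) \<le> f x0 \<and> gap D f (x k) \<le> \<epsilon> k" if "k \<le> R" for k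
    using that
  proof (induction k)
    case 0
    then show ?case
      using run x0 by (simp add: scheduled_restarts_def \<epsilon>_def \<Delta>_def)
  next
    case (Suc k)
    then have IH: "x k \<in> D" "f (x k) \<le> f x0" "gap D f (x k) \<le> \<epsilon> k" and k: "Suc k \<in> {1..R}"
      by auto
    have "x (Suc k) \<in> D \<and> f (x (Suc k)) \<le> f (x k)"
      using U IH(1) \<epsilon>[of "Suc k"] t[OF k] Suc.prems
      by (simp add: step universal_fast_gradient_def)
    moreover have "gap D f (x (Suc k)) \<le> \<epsilon> (Suc k)"
      using counts
    proof
      assume "\<forall>k\<in>{1..R}. first_reached D f U (x (k - 1)) (target \<gamma> (gap D f x0) k) (t k)"
      from bspec[OF this k] show ?thesis
        using Suc.prems by (simp add: step first_reached_def \<epsilon>_def \<Delta>_def del: target.simps)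
    next
      assume "\<forall>k\<in>{1..R}. t k = C * exp (\<gamma> * (1 - tau s r) / rho s)
        * target \<gamma> (gap D f x0) k powr (- (tau s r / rho s))"
      from bspec[OF this k] have "t (Suc k) = T (Suc k)"
        by (simp add: T_def \<epsilon>_def \<Delta>_def del: target.simps)
      then show ?thesis
        using reach[OF IH] Suc.prems by (simp add: step)
    qed
    ultimately show ?case
      using IH by auto
  qed
  \<comment> \<open>A run stopped by the criterion would have reached its target at time
    \<open>T k\<close>, so the first such time is no later.\<close>
  have tT: "t k \<le> T k" if k: "k \<in> {1..R}" for k
    using counts
  proof
    assume "\<forall>k\<in>{1..R}. first_reached D f U (x (k - 1)) (target \<gamma> (gap D f x0) k) (t k)"
    from bspec[OF this k]
    have first: "\<not> gap D f (U (x (k - 1)) (\<epsilon> k) u) \<le> \<epsilon> k" if "0 \<le> u" "u < t k" for u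
      using that by (simp add: first_reached_def \<epsilon>_def \<Delta>_def)
    have "gap D f (U (x (k - 1)) (\<epsilon> k) (T k)) \<le> \<epsilon> k"
      using reach[of "k - 1" "T k"] inv[of "k - 1"] k by auto
    then show ?thesis
      using first[of "T k"] T0[of k] by force
  qed (use k in \<open>simp add: T_def \<epsilon>_def \<Delta>_def\<close>)
  have "exp (- (\<gamma> * real R)) * \<Delta> \<le> restart_bound \<gamma> (rho s) (tau s r) C \<Delta> (\<Sum>k=1..R. t k)"
  proof (rule exp_le_restart_bound)
    show "0 \<le> (\<Sum>k=1..R. t k)"
      by (intro sum_nonneg t)
    have "(\<Sum>k=1..R. t k) \<le> (\<Sum>k=1..R. T k)"
      by (intro sum_mono tT)
    then show "(\<Sum>k=1..R. t k) \<le> (\<Sum>k=1..R. C * exp (\<gamma> * (1 - tau s r) / rho s)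
        * (exp (- (\<gamma> * real k)) * \<Delta>) powr (- (tau s r / rho s)))"
      by (simp add: T_def \<epsilon>_def target_eq)
  qed (use pos C0 gap0 rho_bounds[OF s] in \<open>auto simp: \<Delta>_def\<close>)
  then show ?thesis
    using inv[of R] by (simp add: \<epsilon>_def \<Delta>_def target_eq)
qed

section \<open>The two bounds and the best schedule as instances of the general ones\<close>

lemma criterion_bound_eq:
  "criterion_bound s r \<kappa> \<Delta> N =
    restart_bound 1 (rho s) (tau s r) ((c_const * \<kappa>) powr (s / (2 * rho s))) \<Delta> N"
  by (simp add: criterion_bound_def restart_bound_def powr_minus_divide)

lemma scheduled_bound_eq:
  assumes "rho s \<noteq> 0"
  shows "scheduled_bound s r \<kappa> \<Delta> N =
    restart_bound (rho s) (rho s) (tau s r) ((c_const * \<kappa>) powr (s / (2 * rho s))) \<Delta> N"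
  using assms by (simp add: scheduled_bound_def restart_bound_def powr_minus_divide)

text \<open>For \<gamma> = \<rho>, the factor \<open>exp (- \<rho> * k)\<close> of the target
  becomes \<open>exp (\<tau> * k)\<close> under the power -\<tau>/\<rho>. So the schedule prescribes
  exactly the thresholds of \<open>restart_step\<close>.\<close>

lemma best_schedule_eq:
  assumes "rho s > 0" "\<Delta> > 0"
  shows "best_schedule s r \<kappa> \<Delta> k = (c_const * \<kappa>) powr (s / (2 * rho s))
    * exp (rho s * (1 - tau s r) / rho s) * target (rho s) \<Delta> k powr (- (tau s r / rho s))"
  using assms by (simp add: best_schedule_def target_eq powr_mult exp_powr_real mult_ac)

section \<open>Comparison of the two schemes\<close>

text \<open>Up to a common factor the coefficients of the count are
  \<open>exp (- 1 / \<rho>)\<close> and \<open>\<rho> * exp (- 1)\<close>. By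
  \<open>two_mul_le_exp\<close> the second is at most e/2 times the first, with equality at
  \<open>s = 1\<close>. Suboptimality by e/2 thus means that e/2 times as many iterations give at
  least as good a guarantee.\<close>

lemma criterion_bound_le_scheduled_bound:
  assumes s: "1 \<le> s" "s \<le> 2" and "\<tau> = tau s r" "\<tau> \<ge> 0" "\<Delta> \<ge> 0" "M \<ge> 0"
  shows "criterion_bound s r \<kappa> \<Delta> (exp 1 / 2 * M) \<le> scheduled_bound s r \<kappa> \<Delta> M"
proof -
  define \<rho> where "\<rho> = rho s"
  define P where "P = (c_const * \<kappa>) powr (- s / (2 * \<rho>))"
  have \<rho>: "1/2 \<le> \<rho>" "\<rho> \<le> 2"
    using rho_bounds[OF s] by (simp_all add: \<rho>_def)
  have "\<rho> * exp (- 1) \<le> exp (2 - 1 / \<rho>) / 2 * exp (- 1)"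
    using two_mul_le_exp[OF \<rho>] by (intro mult_right_mono) auto
  also have "\<dots> = exp (- 1 / \<rho>) * (exp 1 / 2)"
    by (simp flip: exp_add)
  finally have rate: "\<rho> * exp (- 1) \<le> exp (- 1 / \<rho>) * (exp 1 / 2)" .
  show ?thesis
  proof (cases "\<tau> = 0")
    case True
    have "\<rho> * exp (- 1) * (P * M) \<le> exp (- 1 / \<rho>) * (exp 1 / 2) * (P * M)"
      using rate assms by (intro mult_right_mono) (auto simp: P_def)
    then have "exp (- (exp (- 1 / \<rho>) * P * (exp 1 / 2 * M))) * \<Delta> \<le> exp (- (\<rho> * exp (- 1) * P * M)) * \<Delta>"
      using assms by (intro mult_right_mono) (auto simp: mult_ac)
    then show ?thesis
      using True assms by (simp add: criterion_bound_def scheduled_bound_def P_def \<rho>_def)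
  next
    case False
    \<comment> \<open>\<open>Q\<close> is the common factor of the two coefficients times the count,
      so \<open>rate\<close> applies to it directly.\<close>
    define Q where "Q = \<tau> / \<rho> * (P * \<Delta> powr (\<tau> / \<rho>) * M)"
    have Q: "Q \<ge> 0"
      using assms \<rho> by (auto simp: Q_def P_def)
    have "\<rho> * exp (- 1) * Q \<le> exp (- 1 / \<rho>) * (exp 1 / 2) * Q"
      using rate Q by (intro mult_right_mono) auto
    then have le: "\<tau> * exp (- 1) * P * \<Delta> powr (\<tau> / \<rho>) * M + 1
        \<le> \<tau> / \<rho> * exp (- 1 / \<rho>) * P * \<Delta> powr (\<tau> / \<rho>) * (exp 1 / 2 * M) + 1"
      using \<rho> by (simp add: Q_def mult_ac)
    have ge: "\<tau> * exp (- 1) * P * \<Delta> powr (\<tau> / \<rho>) * M \<ge> 0"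
      using assms by (auto simp: P_def)
    have "\<Delta> / (\<tau> / \<rho> * exp (- 1 / \<rho>) * P * \<Delta> powr (\<tau> / \<rho>) * (exp 1 / 2 * M) + 1) powr (\<rho> / \<tau>)
        \<le> \<Delta> / (\<tau> * exp (- 1) * P * \<Delta> powr (\<tau> / \<rho>) * M + 1) powr (\<rho> / \<tau>)"
    proof (rule divide_left_mono)
      show "(\<tau> * exp (- 1) * P * \<Delta> powr (\<tau> / \<rho>) * M + 1) powr (\<rho> / \<tau>)
        \<le> (\<tau> / \<rho> * exp (- 1 / \<rho>) * P * \<Delta> powr (\<tau> / \<rho>) * (exp 1 / 2 * M) + 1) powr (\<rho> / \<tau>)"
        using le ge assms \<rho> by (intro powr_mono2) auto
      show "0 < (\<tau> / \<rho> * exp (- 1 / \<rho>) * P * \<Delta> powr (\<tau> / \<rho>) * (exp 1 / 2 * M) + 1) powr (\<rho> / \<tau>)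
        * (\<tau> * exp (- 1) * P * \<Delta> powr (\<tau> / \<rho>) * M + 1) powr (\<rho> / \<tau>)"
        using le ge by (intro mult_pos_pos) auto
    qed (use assms in simp)
    then show ?thesis
      using False assms by (simp add: criterion_bound_def scheduled_bound_def P_def \<rho>_def)
  qed
qed

section \<open>Asymptotic form of the bounds\<close>

text \<open>The rate is uniform in \<open>s\<close> because \<open>1/\<rho> \<le> 2\<close> and \<open>s/(2\<rho>) \<le> 1\<close>.\<close>

lemma criterion_bound_linear_bigo:
  assumes s: "1 \<le> s" "s \<le> 2" and "\<kappa> > 0" "\<Delta> \<ge> 0"
  shows "criterion_bound s s \<kappa> \<Delta>
    \<in> O(\<lambda>M. exp (- (exp (- 2) / c_const * \<kappa> powr (- s / (2 * rho s)) * M)))"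
proof (rule bigoI[where c = \<Delta>])
  define P where "P = \<kappa> powr (- s / (2 * rho s))"
  note rho = rho_bounds[OF s]
  have "c_const \<ge> 1"
    using exp_ge_add_one_self[of "2 / exp 1 :: real"] unfolding c_const_def
    by (smt (verit) divide_nonneg_pos exp_gt_zero)
  then have "c_const powr (- 1) \<le> c_const powr (- s / (2 * rho s))"
    using s rho by (intro powr_mono) (auto simp: rho_def field_simps)
  moreover have "exp (- 2) \<le> exp (- 1 / rho s)"
    using rho by (simp add: field_simps)
  ultimately have "exp (- 2) * c_const powr (- 1) \<le> exp (- 1 / rho s) * c_const powr (- s / (2 * rho s))"
    by (intro mult_mono) auto
  then have rate: "exp (- 2) / c_const \<le> exp (- 1 / rho s) * c_const powr (- s / (2 * rho s))"
    using c_const_pos by (simp add: powr_minus_divide)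
  show "\<forall>\<^sub>F M in at_top. norm (criterion_bound s s \<kappa> \<Delta> M)
      \<le> \<Delta> * norm (exp (- (exp (- 2) / c_const * \<kappa> powr (- s / (2 * rho s)) * M)))"
    using eventually_ge_at_top[of 0]
  proof eventually_elim
    case (elim M)
    have "exp (- 2) / c_const * (P * M) \<le> exp (- 1 / rho s) * c_const powr (- s / (2 * rho s)) * (P * M)"
      using rate elim by (intro mult_right_mono) (auto simp: P_def)
    then have "exp (- (exp (- 1 / rho s) * (c_const powr (- s / (2 * rho s)) * P) * M)) * \<Delta>
        \<le> exp (- (exp (- 2) / c_const * P * M)) * \<Delta>"
      using assms by (intro mult_right_mono) (auto simp: mult_ac)
    \<comment> \<open>Taking \<open>r = s\<close> makes \<open>tau s s\<close> vanish, which selects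
      the exponential branch.\<close>
    moreover have "criterion_bound s s \<kappa> \<Delta> M
        = exp (- (exp (- 1 / rho s) * (c_const powr (- s / (2 * rho s)) * P) * M)) * \<Delta>"
      using s by (simp add: criterion_bound_def tau_def P_def powr_mult)
    ultimately show ?case
      using assms by (simp add: P_def mult.commute)
  qed
qed

text \<open>Dropping the 1 in the denominator only increases the bound and leaves a pure power of
  the count.\<close>

lemma criterion_bound_sublinear_bigo:
  assumes s: "1 \<le> s" "s \<le> 2" and "\<kappa> > 0" "\<Delta> \<ge> 0" and \<tau>: "tau s r > 0"
  shows "criterion_bound s r \<kappa> \<Delta> \<in> O(\<lambda>M. M powr (- rho s / tau s r))"
proof (cases "\<Delta> = 0")
  case True
  then have "criterion_bound s r \<kappa> \<Delta> = (\<lambda>M. 0)"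
    by (auto simp: criterion_bound_def)
  then show ?thesis
    by simp
next
  case False
  \<comment> \<open>\<open>B\<close> is the coefficient of the count in the denominator. Its
    positivity relies on \<open>\<Delta> \<noteq> 0\<close>, as \<open>0 powr a = 0\<close>.\<close>
  define B where "B = tau s r / rho s * exp (- 1 / rho s) * (c_const * \<kappa>) powr (- s / (2 * rho s))
    * \<Delta> powr (tau s r / rho s)"
  note rho = rho_bounds[OF s]
  have B: "B > 0"
    using assms False rho c_const_pos by (simp add: B_def)
  show ?thesis
  proof (rule bigoI[where c = "\<Delta> * B powr (- rho s / tau s r)"])
    show "\<forall>\<^sub>F M in at_top. norm (criterion_bound s r \<kappa> \<Delta> M)
        \<le> \<Delta> * B powr (- rho s / tau s r) * norm (M powr (- rho s / tau s r))"
      using eventually_gt_at_top[of 0]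
    proof eventually_elim
      case (elim M)
      have "(B * M) powr (rho s / tau s r) \<le> (B * M + 1) powr (rho s / tau s r)"
        using B elim \<tau> rho by (intro powr_mono2) auto
      then have "\<Delta> / (B * M + 1) powr (rho s / tau s r) \<le> \<Delta> / (B * M) powr (rho s / tau s r)"
        using B elim assms by (intro divide_left_mono) (auto intro!: mult_pos_pos simp: add_nonneg_eq_0_iff)
      also have "\<dots> = \<Delta> * B powr (- rho s / tau s r) * M powr (- rho s / tau s r)"
        by (simp add: powr_mult powr_minus_divide)
      finally show ?case
        using \<tau> assms by (simp add: criterion_bound_def B_def)
    qed
  qed
qed


section \<open>Rates, asymptotics and suboptimality of the scheme with \<gamma> = 1\<close>

theorem proposition4p1:
  fixes D :: "'a::euclidean_space set" and f :: "'a \<Rightarrow> real"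
    and s L r \<mu> \<rho> \<tau> \<kappa> \<Delta> N :: real
    and U :: "'a \<Rightarrow> real \<Rightarrow> real \<Rightarrow> 'a"
    and x0 :: 'a and R :: nat and x :: "nat \<Rightarrow> 'a" and t :: "nat \<Rightarrow> real"
  assumes "1 \<le> s" "s \<le> 2" "L > 0" "\<mu> > 0" "r \<ge> 1"
    and "\<rho> = rho s" "\<kappa> = kappa s L r \<mu>" "\<tau> = tau s r" "0 \<le> \<tau>" "\<tau> < 1"
    and "convex_on D f" "x0 \<in> D" "minimizers D f \<noteq> {}"
    and "f \<in> holder_class D s L \<inter> lojasiewicz_class D r \<mu> {z \<in> D. f z \<le> f x0}"
    and "universal_fast_gradient D f s L U"
    and "criterion_restarts D f U 1 x0 R x t"
    and "\<Delta> = gap D f x0" "N = (\<Sum>k=1..R. t k)"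
  shows
    "(\<tau> = 0 \<longrightarrow>
        gap D f (x R) \<le> exp (- (exp (- 1 / \<rho>) * (c_const * \<kappa>) powr (- s / (2 * \<rho>)) * N)) * \<Delta>) \<and>
     (\<tau> > 0 \<longrightarrow>
        gap D f (x R) \<le> \<Delta> / (\<tau> / \<rho> * exp (- 1 / \<rho>) * (c_const * \<kappa>) powr (- s / (2 * \<rho>))
                              * \<Delta> powr (\<tau> / \<rho>) * N + 1) powr (\<rho> / \<tau>)) \<and>
     (\<exists>a>0. \<forall>s'\<in>{1..2}. \<forall>\<kappa>'>0. \<forall>\<Delta>'\<ge>0.
        criterion_bound s' s' \<kappa>' \<Delta>' \<in> O(\<lambda>M. exp (- (a * \<kappa>' powr (- s' / (2 * rho s')) * M)))) \<and>
     (\<tau> > 0 \<longrightarrow> criterion_bound s r \<kappa> \<Delta> \<in> O(\<lambda>M. M powr (- \<rho> / \<tau>))) \<and>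
     (\<Delta> > 0 \<longrightarrow> (\<forall>R' y. scheduled_restarts D f U \<rho> x0 R' y (best_schedule s r \<kappa> \<Delta>) \<longrightarrow>
        gap D f (y R') \<le> scheduled_bound s r \<kappa> \<Delta> (\<Sum>k=1..R'. best_schedule s r \<kappa> \<Delta> k))) \<and>
     (\<forall>M\<ge>0. criterion_bound s r \<kappa> \<Delta> (exp 1 / 2 * M) \<le> scheduled_bound s r \<kappa> \<Delta> M) \<and>
     1.3 \<le> exp 1 / (2::real) \<and> exp 1 / (2::real) < 1.4"
proof -
  define C where "C = (c_const * \<kappa>) powr (s / (2 * \<rho>))"
  have loj: "f \<in> lojasiewicz_class D r \<mu> {z \<in> D. f z \<le> f x0}"
    using assms by blast
  \<comment> \<open>The growth condition at \<open>x0\<close>, a point of its own sublevel set,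
    shows that the initial gap is nonnegative.\<close>
  have "0 \<le> \<mu> / r * infdist x0 (minimizers D f) powr r"
    using assms by simp
  also have "\<dots> \<le> \<Delta>"
    using loj assms by (simp add: lojasiewicz_class_def)
  finally have \<Delta>: "\<Delta> \<ge> 0" .
  have \<rho>: "\<rho> > 0"
    using rho_bounds[of s] assms by simp
  have \<kappa>: "\<kappa> > 0"
    using kappa_pos assms by simp
  have criterion: "gap D f (x R) \<le> restart_bound 1 \<rho> \<tau> C \<Delta> N"
  proof (cases "\<Delta> = 0")
    \<comment> \<open>All targets are 0 here, while the error bound of the method requires a
      positive one. The stopping criterion of the last call gives the claim directly; for
      \<open>R = 0\<close> the last point is \<open>x0\<close>.\<close>
    case True
    have "gap D f (x R) \<le> 0"
    proof (cases "R = 0")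
      case True
      then show ?thesis
        using assms \<open>\<Delta> = 0\<close> by (simp add: criterion_restarts_def)
    next
      case False
      then have "first_reached D f U (x (R - 1)) (target 1 (gap D f x0) R) (t R)"
        and "x R = U (x (R - 1)) (target 1 (gap D f x0) R) (t R)"
        using assms by (simp_all add: criterion_restarts_def)
      then show ?thesis
        using \<open>\<Delta> = 0\<close> assms(17) by (simp add: first_reached_def target_eq)
    qed
    then show ?thesis
      using True by (simp add: restart_bound_def)
  next
    case False
    have "gap D f (x R) \<le> restart_bound 1 (rho s) (tau s r) C (gap D f x0) (\<Sum>k=1..R. t k)"
    proof (rule restarts_bound)
      show "scheduled_restarts D f U 1 x0 R x t"
        using assms by (simp add: criterion_restarts_def scheduled_restarts_def)
      show "t k \<ge> 0" if "k \<in> {1..R}" for k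
        using that assms by (auto simp: criterion_restarts_def first_reached_def)
      show "(\<forall>k\<in>{1..R}. first_reached D f U (x (k - 1)) (target 1 (gap D f x0) k) (t k)) \<or>
        (\<forall>k\<in>{1..R}. t k = C * exp (1 * (1 - tau s r) / rho s)
          * target 1 (gap D f x0) k powr (- (tau s r / rho s)))"
        using assms by (simp add: criterion_restarts_def)
    qed (use assms loj False \<Delta> in \<open>auto simp: C_def\<close>)
    then show ?thesis
      using assms by simp
  qed
  have scheduled: "gap D f (y R') \<le> scheduled_bound s r \<kappa> \<Delta> (\<Sum>k=1..R'. best_schedule s r \<kappa> \<Delta> k)"
    if "\<Delta> > 0" "scheduled_restarts D f U \<rho> x0 R' y (best_schedule s r \<kappa> \<Delta>)" for R' y
  proof -
    have "gap D f (y R') \<le> restart_bound (rho s) (rho s) (tau s r) C (gap D f x0)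
        (\<Sum>k=1..R'. best_schedule s r \<kappa> \<Delta> k)"
    proof (rule restarts_bound)
      show "(\<forall>k\<in>{1..R'}. first_reached D f U (y (k - 1)) (target (rho s) (gap D f x0) k)
          (best_schedule s r \<kappa> \<Delta> k)) \<or>
        (\<forall>k\<in>{1..R'}. best_schedule s r \<kappa> \<Delta> k = C * exp (rho s * (1 - tau s r) / rho s)
          * target (rho s) (gap D f x0) k powr (- (tau s r / rho s)))"
        using best_schedule_eq[of s \<Delta>] that \<rho> assms by (simp add: C_def)
      show "best_schedule s r \<kappa> \<Delta> k \<ge> 0" for k
        by (simp add: best_schedule_def)
    qed (use assms loj that \<rho> in \<open>auto simp: C_def\<close>)
    then show ?thesis
      using \<rho> assms by (simp add: scheduled_bound_eq C_def)
  qed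
  \<comment> \<open>The witness for the uniform rate: \<open>exp (- 2)\<close> bounds
    \<open>exp (- 1 / \<rho>)\<close> from below, and \<open>1 / c_const\<close> bounds the power of
    \<open>c_const\<close>.\<close>
  have "exp (- 2) / c_const > 0"
    using c_const_pos by simp
  moreover have "\<forall>s'\<in>{1..2}. \<forall>\<kappa>'>0. \<forall>\<Delta>'\<ge>0. criterion_bound s' s' \<kappa>' \<Delta>'
      \<in> O(\<lambda>M. exp (- (exp (- 2) / c_const * \<kappa>' powr (- s' / (2 * rho s')) * M)))"
    using criterion_bound_linear_bigo by auto
  ultimately have linear: "\<exists>a>0. \<forall>s'\<in>{1..2}. \<forall>\<kappa>'>0. \<forall>\<Delta>'\<ge>0.
      criterion_bound s' s' \<kappa>' \<Delta>' \<in> O(\<lambda>M. exp (- (a * \<kappa>' powr (- s' / (2 * rho s')) * M)))"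
    by blast
  have sublinear: "criterion_bound s r \<kappa> \<Delta> \<in> O(\<lambda>M. M powr (- \<rho> / \<tau>))" if "\<tau> > 0"
    using criterion_bound_sublinear_bigo[of s \<kappa> \<Delta> r] that \<kappa> \<Delta> assms by simp
  have compare: "criterion_bound s r \<kappa> \<Delta> (exp 1 / 2 * M) \<le> scheduled_bound s r \<kappa> \<Delta> M"
    if "M \<ge> 0" for M
    using criterion_bound_le_scheduled_bound[of s \<tau> r \<Delta> M \<kappa>] that \<Delta> assms by simp
  have gap: "gap D f (x R) \<le> criterion_bound s r \<kappa> \<Delta> N"
    using criterion assms(6,8) by (simp add: criterion_bound_eq C_def)
  have zero: "gap D f (x R) \<le> exp (- (exp (- 1 / \<rho>) * (c_const * \<kappa>) powr (- s / (2 * \<rho>)) * N)) * \<Delta>"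
    if "\<tau> = 0"
    using gap that assms(6,8) by (simp add: criterion_bound_def)
  have positive: "gap D f (x R) \<le> \<Delta> / (\<tau> / \<rho> * exp (- 1 / \<rho>) * (c_const * \<kappa>) powr (- s / (2 * \<rho>))
      * \<Delta> powr (\<tau> / \<rho>) * N + 1) powr (\<rho> / \<tau>)" if "\<tau> > 0"
    using gap that assms(6,8) by (simp add: criterion_bound_def)
  have "1.3 \<le> exp 1 / (2::real) \<and> exp 1 / (2::real) < 1.4"
    using exp_one_bounds by simp
  with zero positive linear sublinear scheduled compare show ?thesis
    by blast
qed

end
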